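(* Let $n$ and $k$ be positive integers. Then $$(n!!)^{k}-n^k=(k!!)^{n}-k^n$$ holds if and only if $k=n$ or $(k,n)\in\{(1,2),(2,1),(1,3),(3,1),(2,3),(3,2)\}$.
   Context: For a positive integer $m$, the double factorial $m!!$ is the product of all positive integers $\le m$ having the same parity as $m$, i.e. $m!!=m(m-2)(m-4)\cdots$, ending in $1$ if $m$ is odd and in $2$ if $m$ is even. *)

theory Defs
  imports Complex_Main
begin

definition double_fact :: "nat \<Rightarrow> nat" where
  "double_fact m = \<Prod>{j. 1 \<le> j \<and> j \<le> m \<and> (even j \<longleftrightarrow> even m)}"

lemma double_fact_0: "double_fact 0 = 1"
  unfolding double_fact_def by (rule prod.neutral) simp

lemma double_fact_1: "double_fact (Suc 0) = 1"
  unfolding double_fact_def by (rule prod.neutral) simp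

lemma double_fact_Suc_Suc:
  "double_fact (Suc (Suc m)) = Suc (Suc m) * double_fact m"
proof -
  define S where "S = (\<lambda>m::nat. {j. 1 \<le> j \<and> j \<le> m \<and> (even j \<longleftrightarrow> even m)})"
  have "S (Suc (Suc m)) = insert (Suc (Suc m)) (S m)"
    unfolding S_def by (rule set_eqI) (simp add: le_Suc_eq, fastforce)
  moreover have "finite (S m)"
    unfolding S_def by simp
  moreover have "Suc (Suc m) \<notin> S m"
    unfolding S_def by simp
  moreover have "double_fact x = \<Prod>(S x)" for x
    unfolding S_def by (rule double_fact_def)
  ultimately show ?thesis
    by (simp del: mult_Suc)
qed

end

theory Submission
  imports Defs
begin

text \<open>
  Let \<open>k < n\<close>. The sequence \<open>(m!!)\<^bsup>1/m\<^esup>\<close> is strictly increasing (by induction in steps of two,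
  using \<open>(m + 2) (m!!)\<^sup>2 \<le> 2 ((m + 1)!!)\<^sup>2\<close>), so \<open>(k!!)\<^sup>n < (n!!)\<^sup>k\<close>. On the other hand,
  \<open>m\<^bsup>1/m\<^esup>\<close> is decreasing for \<open>m \<ge> 3\<close>, so \<open>n\<^sup>k \<le> k\<^sup>n\<close> when \<open>k \<ge> 3\<close>, and the left side is
  strictly larger than the right side. For \<open>k \<le> 2\<close> the right side vanishes,
  and the equation becomes \<open>n!! = n\<close>.
\<close>

lemma double_fact_pos: "double_fact m > 0"
  unfolding double_fact_def by (rule prod_pos) auto

text \<open>Going from \<open>m\<close> to \<open>m + 2\<close> multiplies the two sides by
  \<open>(m + 4) * (m + 2)\<close> and \<open>(m + 3)^2\<close>, and the first factor is smaller by
  1.\<close>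

lemma double_fact_consecutive_sq:
  "(m + 2) * double_fact m ^ 2 \<le> 2 * double_fact (Suc m) ^ 2"
proof (induction m rule: induct_nat_012)
  case 0
  then show ?case by (simp add: double_fact_0 double_fact_1)
next
  case 1
  then show ?case
    by (simp add: double_fact_0 double_fact_1 double_fact_Suc_Suc power2_eq_square)
next
  case (ge2 m)
  have rec: "double_fact (Suc (Suc m)) = (m + 2) * double_fact m"
    "double_fact (Suc (Suc (Suc m))) = (m + 3) * double_fact (Suc m)"
    by (simp_all add: double_fact_Suc_Suc numeral_eq_Suc del: mult_Suc)
  \<comment> \<open>The extra factor \<open>m + 2\<close> makes the left side of the induction
    hypothesis appear without division; it is cancelled at the end.\<close>
  have "(m + 2) * ((m + 4) * double_fact (Suc (Suc m)) ^ 2)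
      = ((m + 4) * (m + 2)^2) * ((m + 2) * double_fact m ^ 2)"
    unfolding rec by (simp only: power_mult_distrib power2_eq_square mult_ac)
  also have "\<dots> \<le> ((m + 2) * (m + 3)^2) * (2 * double_fact (Suc m) ^ 2)"
    by (rule mult_le_mono[OF _ ge2.IH(1)]) (simp add: power2_eq_square algebra_simps)
  also have "\<dots> = (m + 2) * (2 * double_fact (Suc (Suc (Suc m))) ^ 2)"
    unfolding rec by (simp only: power_mult_distrib power2_eq_square mult_ac)
  finally have "(m + 4) * double_fact (Suc (Suc m)) ^ 2 \<le> 2 * double_fact (Suc (Suc (Suc m))) ^ 2"
    by (simp only: mult_le_cancel1)
  thus ?case by (simp add: numeral_eq_Suc)
qed

text \<open>Bernoulli's inequality gives \<open>(1 + 1/m)^m \<ge> 1 + m * (1/m) = 2\<close>.\<close>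

lemma two_mult_power_le_Suc_power:
  fixes m :: nat
  assumes "m > 0"
  shows "2 * m ^ m \<le> Suc m ^ m"
proof -
  have "2 \<le> (1 + 1 / real m) ^ m"
    using Bernoulli_inequality[of "1 / real m" m] order_trans[of "- 1" 0 "1 / real m"] assms
    by simp
  hence "2 * real m ^ m \<le> (1 + 1 / real m) ^ m * real m ^ m"
    by (intro mult_right_mono) auto
  also have "\<dots> = real (Suc m) ^ m"
    using assms by (simp add: power_mult_distrib[symmetric] field_simps)
  finally have "real (2 * m ^ m) \<le> real (Suc m ^ m)" by simp
  thus ?thesis by (simp only: of_nat_le_iff)
qed

lemma double_fact_power_Suc_less:
  assumes "m > 0"
  shows "double_fact m ^ Suc m < double_fact (Suc m) ^ m"
  using assms
proof (induction m rule: induct_nat_012)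
  case 0
  then show ?case by simp
next
  case 1
  then show ?case by (simp add: double_fact_0 double_fact_1 double_fact_Suc_Suc)
next
  case (ge2 m)
  let ?a = "double_fact m" and ?b = "double_fact (Suc m)"
  have IH: "?a ^ Suc m < ?b ^ m" if "m > 0" using ge2.IH(1) that .
  show ?case
  \<comment> \<open>The induction hypothesis is vacuous at \<open>m = 0\<close>; there the claim is
    \<open>2^3 < 3^2\<close>.\<close>
  proof (cases "m = 0")
    case True
    then show ?thesis by (simp add: double_fact_0 double_fact_1 double_fact_Suc_Suc)
  next
    case False
    define c d where "c = Suc (Suc m)" and "d = Suc c"
    have rec: "double_fact (Suc (Suc m)) = c * ?a" "double_fact (Suc (Suc (Suc m))) = d * ?b"
      by (simp_all only: c_def d_def double_fact_Suc_Suc)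
    have sq: "c * ?a ^ 2 \<le> 2 * ?b ^ 2"
      using double_fact_consecutive_sq[of m] by (simp add: c_def)
    \<comment> \<open>Each of the three factors gets its own bound:
      \<open>2 * c^c \<le> d^c\<close>, then \<open>sq\<close>, then the induction hypothesis. The
      initial 2 pays for the first bound and reappears through \<open>sq\<close>.\<close>
    have "2 * double_fact (Suc (Suc m)) ^ Suc (Suc (Suc m))
        = (2 * c ^ Suc (Suc m)) * (c * ?a ^ 2) * ?a ^ Suc m"
      unfolding rec by (simp add: power_mult_distrib power2_eq_square mult_ac)
    also have "\<dots> \<le> d ^ Suc (Suc m) * (2 * ?b ^ 2) * ?a ^ Suc m"
      using two_mult_power_le_Suc_power[of c] sq
      by (intro mult_right_mono[OF mult_mono]) (simp_all add: c_def d_def del: mult_Suc power_Suc)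
    also have "\<dots> < d ^ Suc (Suc m) * (2 * ?b ^ 2) * ?b ^ m"
      using IH False by (intro mult_strict_left_mono) (simp_all add: d_def double_fact_pos)
    also have "\<dots> = 2 * double_fact (Suc (Suc (Suc m))) ^ Suc (Suc m)"
      unfolding rec by (simp add: power_mult_distrib power2_eq_square mult_ac)
    finally show ?thesis by simp
  qed
qed

text \<open>The comparison of neighbours is chained from \<open>k\<close> up to
  \<open>n\<close>.\<close>

lemma double_fact_power_less:
  assumes "k > 0" and "k < n"
  shows "double_fact k ^ n < double_fact n ^ k"
proof -
  have "Suc k \<le> n" using assms by simp
  thus ?thesis
  proof (induction n rule: dec_induct)
    case base
    show ?case by (rule double_fact_power_Suc_less[OF assms(1)])
  next
    case (step n)
    \<comment> \<open>Raising to the power \<open>n\<close> replaces transitivity for real roots: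
      all terms get integer exponents, and the \<open>n\<close>-th power is removed at the
      end.\<close>
    have "(double_fact k ^ Suc n) ^ n = (double_fact k ^ n) ^ Suc n"
      by (metis power_mult mult.commute)
    also have "\<dots> < (double_fact n ^ k) ^ Suc n"
      using step.IH by (intro power_strict_mono) auto
    also have "\<dots> = (double_fact n ^ Suc n) ^ k"
      by (metis power_mult mult.commute)
    also have "\<dots> < (double_fact (Suc n) ^ n) ^ k"
      using double_fact_power_Suc_less[of n] step.hyps assms(1)
      by (intro power_strict_mono) auto
    also have "\<dots> = (double_fact (Suc n) ^ k) ^ n"
      by (metis power_mult mult.commute)
    finally show ?case
      by (rule power_less_imp_less_base) simp
  qed
qed

lemma power_swap_le:
  fixes k n :: nat
  assumes "3 \<le> k" and "k \<le> n"
  shows "n ^ k \<le> k ^ n"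
proof -
  \<comment> \<open>The function \<open>ln x / x\<close> decreases only from \<open>exp 1\<close>
    on, which lies below 3.\<close>
  have "exp 1 \<le> real k" using exp_le assms by linarith
  hence "ln (real n) / real n \<le> ln (real k) / real k"
    using assms by (intro ln_x_over_x_mono) auto
  hence "ln (real n ^ k) \<le> ln (real k ^ n)"
    using assms by (simp add: field_simps ln_realpow)
  hence "real (n ^ k) \<le> real (k ^ n)"
    using assms by simp
  thus ?thesis by (simp only: of_nat_le_iff)
qed

text \<open>From \<open>n = 4\<close> on, the product contains the factor
  \<open>n - 2 \<ge> 2\<close> besides \<open>n\<close>.\<close>

lemma double_fact_eq_self_iff:
  assumes "n > 0"
  shows "double_fact n = n \<longleftrightarrow> n \<le> 3"
proof
  assume eq: "double_fact n = n"
  show "n \<le> 3"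
  proof (rule ccontr)
    assume "\<not> n \<le> 3"
    then obtain m where n: "n = m + 4"
      by (auto dest: less_imp_Suc_add simp: not_le)
    have "double_fact n = n * ((m + 2) * double_fact m)"
      by (simp add: n double_fact_Suc_Suc numeral_eq_Suc del: mult_Suc)
    with eq assms have "(m + 2) * double_fact m = 1" by simp
    thus False unfolding nat_mult_eq_1_iff by simp
  qed
next
  assume "n \<le> 3"
  with assms have "n = 1 \<or> n = 2 \<or> n = 3" by auto
  thus "double_fact n = n"
    by (auto simp: double_fact_0 double_fact_1 double_fact_Suc_Suc numeral_eq_Suc)
qed

lemma double_fact_equation_less:
  fixes n k :: nat
  assumes "k > 0" and "k < n"
  shows "int (double_fact n) ^ k - int n ^ k = int (double_fact k) ^ n - int k ^ n
    \<longleftrightarrow> (k, n) \<in> {(1, 2), (1, 3), (2, 3)}"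
proof (cases "3 \<le> k")
  case True
  \<comment> \<open>Moving the subtracted powers across keeps the comparison within the natural
    numbers.\<close>
  have "double_fact k ^ n + n ^ k < double_fact n ^ k + k ^ n"
    using double_fact_power_less[OF assms] power_swap_le[OF True] assms(2)
    by (intro add_less_le_mono) auto
  hence "int (double_fact k) ^ n + int n ^ k < int (double_fact n) ^ k + int k ^ n"
    by (metis of_nat_add of_nat_less_iff of_nat_power)
  thus ?thesis using True by auto
next
  case False
  hence "double_fact k = k" using assms double_fact_eq_self_iff by simp
  hence "int (double_fact n) ^ k - int n ^ k = int (double_fact k) ^ n - int k ^ n
      \<longleftrightarrow> int (double_fact n) ^ k = int n ^ k" by simp
  also have "\<dots> \<longleftrightarrow> double_fact n = n"
    using assms by (simp add: power_eq_iff_eq_base)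
  also have "\<dots> \<longleftrightarrow> n \<le> 3" using assms by (intro double_fact_eq_self_iff) simp
  also have "\<dots> \<longleftrightarrow> (k, n) \<in> {(1, 2), (1, 3), (2, 3)}"
    using False assms by auto
  finally show ?thesis .
qed

theorem theorem1p1:
  fixes n k :: nat
  assumes "n > 0" and "k > 0"
  shows "int (double_fact n) ^ k - int n ^ k = int (double_fact k) ^ n - int k ^ n
    \<longleftrightarrow> k = n \<or> (k, n) \<in> {(1, 2), (2, 1), (1, 3), (3, 1), (2, 3), (3, 2)}"
proof (cases k n rule: linorder_cases)
  case less
  show ?thesis
    using less by (subst double_fact_equation_less[OF assms(2) less]) auto
next
  case equal
  thus ?thesis by simp
next
  case greater
  \<comment> \<open>Exchanging \<open>k\<close> and \<open>n\<close> only swaps the two sides of the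
    equation.\<close>
  show ?thesis
    using greater by (subst eq_commute, subst double_fact_equation_less[OF assms(1) greater]) auto
qed

end
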